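(* Let $A \subseteq \mathbb{N}$ be an arbitrary set. Then $A$ contains a subset $B$ satisfying \[ \sup_{\substack{n, m \in B \\ n \neq m}} \gcd(m, n) < \infty \quad \text{and} \quad \sum_{n \in B} \frac{1}{n} = \infty \] if and only if there exist $n_0 \in \mathbb{N}$ and a set of primes $\mathcal{P} \subseteq \mathbb{P}$ such that $n_0 \mathcal{P} \subseteq A$ and $\sum_{p \in \mathcal{P}} \frac{1}{p} = \infty$.
   Context: $\mathbb{N}$ denotes the positive integers, $\mathbb{P}$ the set of primes, and $n_0\mathcal{P} = \{n_0 p : p \in \mathcal{P}\}$. *)

theory Defs
  imports "HOL-Analysis.Infinite_Sum" "HOL-Library.Extended_Nat"
    "HOL-Library.Extended_Nonnegative_Real" "HOL-Computational_Algebra.Primes"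
begin

end

(* Let K bound the pairwise gcds in B. A divisor d > K of an element of B determines that
   element, so the elements n of B having a divisor d > K with d^2 <= K n contribute at most
   K times the sum of 1/d^2. Every other n > K has the form m p with p prime and m <= K: if d is
   its least divisor exceeding K and p is a prime factor of d, then d/p <= K, hence p > n/d, so
   that (n/d) (d/p) = n/p is a divisor of n below d. Thus one of finitely many multipliers m
   carries a divergent part of the sum. *)
theory Submission
  imports Defs "HOL-Analysis.Summation_Tests"
begin

text \<open>A sum in \<open>ennreal\<close> always exists as the supremum of its finite partial
  sums, and bounded partial sums of nonnegative reals mean summability. This moves the whole
  argument to \<open>summable_on\<close> over the reals, where subsets, unions and comparison are at
  hand.\<close>

lemma infsum_ennreal_eq_infinity_iff:
  fixes f :: "'a \<Rightarrow> real"
  assumes nonneg: "\<And>x. x \<in> S \<Longrightarrow> 0 \<le> f x"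
  shows "(\<Sum>\<^sub>\<infinity>x\<in>S. ennreal (f x)) = \<infinity> \<longleftrightarrow> \<not> f summable_on S"
proof -
  have sum_eq: "(\<Sum>x\<in>F. ennreal (f x)) = ennreal (sum f F)" if "F \<subseteq> S" for F
    using nonneg that by (intro sum_ennreal) auto
  have infsum_eq: "(\<Sum>\<^sub>\<infinity>x\<in>S. ennreal (f x)) = (SUP F\<in>{F. finite F \<and> F \<subseteq> S}. ennreal (sum f F))"
    by (subst nonneg_infsum_complete) (auto intro!: SUP_cong simp: sum_eq)
  show ?thesis
  proof
    assume inf: "(\<Sum>\<^sub>\<infinity>x\<in>S. ennreal (f x)) = \<infinity>"
    show "\<not> f summable_on S"
    proof
      assume "f summable_on S"
      from infsum_nonneg_is_SUPREMUM_ennreal[OF this nonneg]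
      have "ennreal (infsum f S) = \<infinity>"
        using inf unfolding infsum_eq by metis
      then show False
        by simp
    qed
  next
    assume not_summable: "\<not> f summable_on S"
    show "(\<Sum>\<^sub>\<infinity>x\<in>S. ennreal (f x)) = \<infinity>"
    proof (rule ccontr)
      assume "(\<Sum>\<^sub>\<infinity>x\<in>S. ennreal (f x)) \<noteq> \<infinity>"
      then obtain c where c: "0 \<le> c" "(\<Sum>\<^sub>\<infinity>x\<in>S. ennreal (f x)) = ennreal c"
        by (metis ennreal_cases infinity_ennreal_def)
      have "sum f F \<le> c" if "finite F" "F \<subseteq> S" for F
      proof -
        have "ennreal (sum f F) \<le> ennreal c"
          unfolding c(2)[symmetric] infsum_eq using that by (intro SUP_upper) auto
        then show ?thesis
          using c(1) by simp
      qed
      then have "bdd_above (sum f ` {F. F \<subseteq> S \<and> finite F})"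
        by (intro bdd_aboveI[of _ c]) auto
      with nonneg have "f summable_on S"
        by (intro nonneg_bdd_above_summable_on) auto
      with not_summable show False ..
    qed
  qed
qed

lemma prime_multiple_or_divisor_le_sqrt:
  fixes n K :: nat
  assumes "1 \<le> K" "K < n"
  obtains m p where "0 < m" "m \<le> K" "prime p" "n = m * p"
  | d where "d dvd n" "K < d" "d\<^sup>2 \<le> K * n"
proof -
  define d where "d = (LEAST d. d dvd n \<and> K < d)"
  have d: "d dvd n" "K < d"
    \<comment> \<open>The minimum exists because \<open>n\<close> itself is a divisor exceeding
      \<open>K\<close>.\<close>
    using LeastI[of "\<lambda>d. d dvd n \<and> K < d" n] assms by (auto simp: d_def)
  have least: "e \<le> K" if "e dvd n" "e < d" for e
    using that not_less_Least[of e "\<lambda>d. d dvd n \<and> K < d"] by (auto simp: d_def)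
  obtain e where e: "n = d * e"
    using d(1) by blast
  obtain p where p: "prime p" "p dvd d"
    using d assms prime_factor_nat[of d] by auto
  then obtain c where c: "d = p * c"
    by blast
  have pos: "0 < c" "0 < e"
    using d c e assms by (auto intro: Nat.gr0I)
  \<comment> \<open>\<open>c\<close> divides \<open>n\<close> and is smaller than
    \<open>d = p * c\<close>, so minimality of \<open>d\<close> applies.\<close>
  have "c \<le> K"
    using p c pos e prime_gt_1_nat[of p] by (intro least) auto
  show thesis
  \<comment> \<open>Here \<open>n = p * c * e\<close>. If \<open>p\<close> is at most the cofactor
    \<open>e\<close>, then \<open>d = p * c\<close> is at most \<open>K * e\<close>, and multiplying
    by \<open>d\<close> gives the square bound. Otherwise replacing \<open>p\<close> by
    \<open>e\<close> in \<open>d\<close> gives the smaller divisor \<open>c * e\<close>, which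
    serves as the multiplier of \<open>p\<close>.\<close>
  proof (cases "p \<le> e")
    case True
    then have "d \<le> K * e"
      using c \<open>c \<le> K\<close> mult_le_mono[of p e c K] by (simp add: mult.commute)
    then have "d\<^sup>2 \<le> K * n"
      using e mult_le_mono2[of d "K * e" d] by (simp add: power2_eq_square ac_simps)
    with d show thesis
      using that(2) by blast
  next
    case False
    then have "c * e < d"
      using c pos by simp
    then have "c * e \<le> K"
      using c e by (intro least) auto
    with p pos c e show thesis
      by (intro that(1)[of "c * e" p]) auto
  qed
qed

lemma summable_on_reciprocals_mult_iff:
  fixes m :: nat
  assumes "0 < m"
  shows "(\<lambda>n. 1 / real n) summable_on (\<lambda>p. m * p) ` P \<longleftrightarrow> (\<lambda>p. 1 / real p) summable_on P"
proof -
  have "inj_on (\<lambda>p. m * p) P"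
    using assms by (auto intro: inj_onI)
  then have "(\<lambda>n. 1 / real n) summable_on (\<lambda>p. m * p) ` P
      \<longleftrightarrow> (\<lambda>p. (1 / real m) * (1 / real p)) summable_on P"
    by (subst summable_on_reindex) (simp_all add: o_def)
  also have "\<dots> \<longleftrightarrow> (\<lambda>p. 1 / real p) summable_on P"
    using assms by (subst summable_on_cmult_right') auto
  finally show ?thesis .
qed

text \<open>The bound says that \<open>1 / n\<close> is at most \<open>K / (d n)^2\<close>; by
  injectivity the majorant sums to at most \<open>K\<close> times the convergent sum of inverse
  squares.\<close>

lemma summable_on_reciprocals_if_inj_divisor:
  fixes C :: "nat set" and d :: "nat \<Rightarrow> nat"
  assumes inj: "inj_on d C"
    and bound: "\<And>n. n \<in> C \<Longrightarrow> 0 < d n \<and> (d n)\<^sup>2 \<le> K * n"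
  shows "(\<lambda>n. 1 / real n) summable_on C"
proof (rule summable_on_comparison_test)
  have "summable (\<lambda>n. inverse (real n ^ 2))"
    by (rule inverse_power_summable) simp
  then have "(\<lambda>n. inverse (real n ^ 2)) summable_on UNIV"
    by (intro summable_nonneg_imp_summable_on) auto
  then have "(\<lambda>n. inverse (real n ^ 2)) summable_on d ` C"
    by (rule summable_on_subset) auto
  then have "(\<lambda>n. inverse (real (d n) ^ 2)) summable_on C"
    using inj by (simp add: summable_on_reindex o_def)
  then show "(\<lambda>n. real K * inverse (real (d n) ^ 2)) summable_on C"
    by (rule summable_on_cmult_right)
next
  fix n assume "n \<in> C"
  then have d: "0 < d n" "(d n)\<^sup>2 \<le> K * n"
    using bound by auto
  \<comment> \<open>\<open>n = 0\<close> would force \<open>d n = 0\<close> through the square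
    bound.\<close>
  then have "0 < n"
    by (auto intro: Nat.gr0I)
  moreover have "(real (d n))\<^sup>2 \<le> real K * real n"
    using d(2) by (metis of_nat_le_iff of_nat_mult of_nat_power)
  ultimately show "1 / real n \<le> real K * inverse (real (d n) ^ 2)"
    using d(1) by (simp add: field_simps)
qed auto

text \<open>If every multiplier gave a convergent sum, \<open>B\<close> would be covered by finitely
  many sets with summable reciprocals: the numbers up to \<open>K\<close>, the sets
  \<open>M m\<close> with \<open>m\<close> from 1 to \<open>K\<close>, and the set \<open>C\<close>
  of elements with a divisor above \<open>K\<close> that is small against the square root.\<close>

lemma prime_multiples_in_bounded_gcd_set:
  fixes B :: "nat set" and K :: nat
  assumes gcd_le: "\<And>m n. m \<in> B \<Longrightarrow> n \<in> B \<Longrightarrow> m \<noteq> n \<Longrightarrow> gcd m n \<le> K"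
    and K: "1 \<le> K"
    and diverges: "\<not> (\<lambda>n. 1 / real n) summable_on B"
  shows "\<exists>m>0. \<not> (\<lambda>p. 1 / real p) summable_on {p. prime p \<and> m * p \<in> B}"
proof (rule ccontr)
  assume "\<not> ?thesis"
  then have conv: "(\<lambda>p. 1 / real p) summable_on {p. prime p \<and> m * p \<in> B}" if "0 < m" for m
    using that by blast
  define M where "M m = (\<lambda>p. m * p) ` {p. prime p \<and> m * p \<in> B}" for m
  define C where "C = {n \<in> B. \<exists>d. d dvd n \<and> K < d \<and> d\<^sup>2 \<le> K * n}"
  have "\<forall>n\<in>C. \<exists>d. d dvd n \<and> K < d \<and> d\<^sup>2 \<le> K * n"
    by (auto simp: C_def)
  then obtain d where d: "\<And>n. n \<in> C \<Longrightarrow> d n dvd n \<and> K < d n \<and> (d n)\<^sup>2 \<le> K * n"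
    by metis
  \<comment> \<open>A value shared by two distinct elements would divide their gcd, which is at most
    \<open>K\<close>, although it exceeds \<open>K\<close>. The gcd is nonzero since distinct
    numbers are not both 0.\<close>
  have "inj_on d C"
  proof (rule inj_onI, rule ccontr)
    fix x y assume xy: "x \<in> C" "y \<in> C" "d x = d y" "x \<noteq> y"
    then have le: "gcd x y \<le> K"
      using gcd_le by (auto simp: C_def)
    have "d x dvd gcd x y"
      using d xy by (metis gcd_greatest)
    moreover have "gcd x y \<noteq> 0"
      using xy by auto
    ultimately have "d x \<le> gcd x y"
      using dvd_imp_le by blast
    then show False
      using d[OF xy(1)] le by linarith
  qed
  then have "(\<lambda>n. 1 / real n) summable_on C"
    by (rule summable_on_reciprocals_if_inj_divisor[where K = K]) (use d in force)
  \<comment> \<open>The sets \<open>M m\<close> may overlap, as 2 * 3 = 3 * 2 shows; this does no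
    harm to summability of a union.\<close>
  moreover have "(\<lambda>n. 1 / real n) summable_on (\<Union>m\<in>{1..k}. M m)" for k
  proof (induction k)
    case (Suc k)
    have "(\<lambda>n. 1 / real n) summable_on M (Suc k)"
      using conv[of "Suc k"] unfolding M_def by (subst summable_on_reciprocals_mult_iff) auto
    then have "(\<lambda>n. 1 / real n) summable_on M (Suc k) \<union> (\<Union>m\<in>{1..k}. M m)"
      using Suc by (intro summable_on_union) auto
    then show ?case
      by (simp add: atLeastAtMostSuc_conv)
  qed simp
  moreover have "(\<lambda>n. 1 / real n) summable_on {..K}"
    by simp
  ultimately have "(\<lambda>n. 1 / real n) summable_on {..K} \<union> (\<Union>m\<in>{1..K}. M m) \<union> C"
    by (intro summable_on_union)
  moreover have "B \<subseteq> {..K} \<union> (\<Union>m\<in>{1..K}. M m) \<union> C"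
  proof
    fix n assume n: "n \<in> B"
    show "n \<in> {..K} \<union> (\<Union>m\<in>{1..K}. M m) \<union> C"
    proof (cases "n \<le> K")
      case False
      then have "K < n"
        by simp
      with K show ?thesis
        by (cases rule: prime_multiple_or_divisor_le_sqrt) (use n in \<open>auto simp: M_def C_def Suc_le_eq\<close>)
    qed auto
  qed
  ultimately have "(\<lambda>n. 1 / real n) summable_on B"
    by (rule summable_on_subset)
  with diverges show False ..
qed

theorem theoremA1:
  fixes A :: "nat set"
  assumes "A \<subseteq> {0<..}"
  shows "(\<exists>B \<subseteq> A. (SUP (m, n) \<in> {(m, n). m \<in> B \<and> n \<in> B \<and> m \<noteq> n}. enat (gcd m n)) < \<infinity>
             \<and> (\<Sum>\<^sub>\<infinity>n\<in>B. ennreal (1 / real n)) = \<infinity>)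
     \<longleftrightarrow> (\<exists>n\<^sub>0 > 0. \<exists>P \<subseteq> {p::nat. prime p}. (\<lambda>p. n\<^sub>0 * p) ` P \<subseteq> A
             \<and> (\<Sum>\<^sub>\<infinity>p\<in>P. ennreal (1 / real p)) = \<infinity>)"
proof
  assume "\<exists>B \<subseteq> A. (SUP (m, n) \<in> {(m, n). m \<in> B \<and> n \<in> B \<and> m \<noteq> n}. enat (gcd m n)) < \<infinity>
             \<and> (\<Sum>\<^sub>\<infinity>n\<in>B. ennreal (1 / real n)) = \<infinity>"
  then obtain B where B: "B \<subseteq> A"
      "(SUP (m, n) \<in> {(m, n). m \<in> B \<and> n \<in> B \<and> m \<noteq> n}. enat (gcd m n)) < \<infinity>"
      "(\<Sum>\<^sub>\<infinity>n\<in>B. ennreal (1 / real n)) = \<infinity>"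
    by blast
  from B(2) obtain k where
    k: "(SUP (m, n) \<in> {(m, n). m \<in> B \<and> n \<in> B \<and> m \<noteq> n}. enat (gcd m n)) = enat k"
    by (rule less_infinityE)
  \<comment> \<open>The maximum with 1 meets the hypothesis \<open>1 \<le> K\<close> of the
    decomposition, where it ensures that a divisor above \<open>K\<close> has a prime
    factor.\<close>
  have gcd_le: "gcd m n \<le> max 1 k" if "m \<in> B" "n \<in> B" "m \<noteq> n" for m n
  proof -
    have "enat (gcd m n) \<le> enat k"
      unfolding k[symmetric] using that by (intro SUP_upper2[of "(m, n)"]) auto
    then show ?thesis
      by simp
  qed
  have "\<not> (\<lambda>n. 1 / real n) summable_on B"
    using B(3) by (subst (asm) infsum_ennreal_eq_infinity_iff) auto
  with gcd_le obtain m
    where m: "0 < m" "\<not> (\<lambda>p. 1 / real p) summable_on {p. prime p \<and> m * p \<in> B}"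
    using prime_multiples_in_bounded_gcd_set[of B "max 1 k"] by auto
  have "(\<Sum>\<^sub>\<infinity>p\<in>{p. prime p \<and> m * p \<in> B}. ennreal (1 / real p)) = \<infinity>"
    using m(2) by (subst infsum_ennreal_eq_infinity_iff) auto
  with m(1) B(1) show "\<exists>n\<^sub>0 > 0. \<exists>P \<subseteq> {p::nat. prime p}. (\<lambda>p. n\<^sub>0 * p) ` P \<subseteq> A
             \<and> (\<Sum>\<^sub>\<infinity>p\<in>P. ennreal (1 / real p)) = \<infinity>"
    by (intro exI[of _ m] conjI exI[of _ "{p. prime p \<and> m * p \<in> B}"]) auto
next
  assume "\<exists>n\<^sub>0 > 0. \<exists>P \<subseteq> {p::nat. prime p}. (\<lambda>p. n\<^sub>0 * p) ` P \<subseteq> A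
             \<and> (\<Sum>\<^sub>\<infinity>p\<in>P. ennreal (1 / real p)) = \<infinity>"
  then obtain m P where m: "0 < m" and P: "P \<subseteq> {p::nat. prime p}" "(\<lambda>p. m * p) ` P \<subseteq> A"
      "(\<Sum>\<^sub>\<infinity>p\<in>P. ennreal (1 / real p)) = \<infinity>"
    by blast
  let ?B = "(\<lambda>p. m * p) ` P"
  \<comment> \<open>Distinct elements of \<open>?B\<close> come from distinct, hence coprime,
    primes, so only the common factor \<open>m\<close> survives.\<close>
  have gcd_eq: "gcd x y = m" if xy: "x \<in> ?B" "y \<in> ?B" "x \<noteq> y" for x y
  proof -
    obtain p q where pq: "p \<in> P" "q \<in> P" "x = m * p" "y = m * q" "p \<noteq> q"
      using xy by auto
    then have "coprime p q"
      using P(1) by (intro primes_coprime) auto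
    then show ?thesis
      using pq by (simp add: gcd_mult_distrib_nat[symmetric])
  qed
  have "(SUP (x, y) \<in> {(x, y). x \<in> ?B \<and> y \<in> ?B \<and> x \<noteq> y}. enat (gcd x y)) \<le> enat m"
    by (rule SUP_least) (auto simp: gcd_eq)
  also have "\<dots> < \<infinity>"
    by simp
  finally have "(SUP (x, y) \<in> {(x, y). x \<in> ?B \<and> y \<in> ?B \<and> x \<noteq> y}. enat (gcd x y)) < \<infinity>" .
  moreover have "\<not> (\<lambda>p. 1 / real p) summable_on P"
    using P(3) by (subst (asm) infsum_ennreal_eq_infinity_iff) auto
  \<comment> \<open>Passing from \<open>P\<close> to \<open>?B\<close> only scales the reciprocals
    by the nonzero constant \<open>1 / m\<close>.\<close>
  then have "\<not> (\<lambda>n. 1 / real n) summable_on ?B"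
    using m by (simp add: summable_on_reciprocals_mult_iff)
  then have "(\<Sum>\<^sub>\<infinity>n\<in>?B. ennreal (1 / real n)) = \<infinity>"
    by (subst infsum_ennreal_eq_infinity_iff) auto
  ultimately show "\<exists>B \<subseteq> A. (SUP (m, n) \<in> {(m, n). m \<in> B \<and> n \<in> B \<and> m \<noteq> n}. enat (gcd m n)) < \<infinity>
             \<and> (\<Sum>\<^sub>\<infinity>n\<in>B. ennreal (1 / real n)) = \<infinity>"
    using P(2) by blast
qed

end
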